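(* Let $k\geq 3$ and $\ell\geq 1$ be integers. Then $\mathrm{sat}_k(n,\text{Berge-}\ell K_2)=\ell-1$ for all $n\geq k(\ell-1)$.
   Context: Hypergraphs are finite and have no repeated edges; a hypergraph is $k$-uniform if every edge has exactly $k$ vertices. $\ell K_2$ is the graph consisting of $\ell$ pairwise disjoint edges. For a graph $F$, a hypergraph $B$ is a Berge-$F$ if (with $V(F)$ identified with distinct vertices of $B$) there is a bijection $\phi:E(F)\to E(B)$ with $e\subseteq\phi(e)$ for all $e\in E(F)$. A hypergraph contains a Berge-$F$ if some subhypergraph of it is a Berge-$F$. A $k$-uniform hypergraph $H$ is Berge-$F$-saturated if $H$ contains no Berge-$F$, but for every $k$-subset $e$ of $V(H)$ with $e\notin E(H)$ the hypergraph $H+e$ contains a Berge-$F$. $\mathrm{sat}_k(n,\text{Berge-}F)$ is the minimum number of edges of a $k$-uniform Berge-$F$-saturated hypergraph on $n$ vertices. *)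

theory Defs
  imports Main "HOL-Library.Extended_Nat"
begin

text \<open>Edges form a set of vertex sets, so there are no repeated edges. A graph is regarded as a
  2-uniform hypergraph.\<close>

record 'a hypergraph =
  verts :: "'a set"
  edges :: "'a set set"

definition is_hypergraph :: "'a hypergraph \<Rightarrow> bool" where
  "is_hypergraph H \<longleftrightarrow> finite (verts H) \<and> (\<forall>e \<in> edges H. e \<subseteq> verts H)"

definition uniform :: "nat \<Rightarrow> 'a hypergraph \<Rightarrow> bool" where
  "uniform k H \<longleftrightarrow> (\<forall>e \<in> edges H. card e = k)"

definition subhypergraph :: "'a hypergraph \<Rightarrow> 'a hypergraph \<Rightarrow> bool" where
  "subhypergraph B H \<longleftrightarrow> is_hypergraph B \<and> verts B \<subseteq> verts H \<and> edges B \<subseteq> edges H"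

definition add_edge :: "'a hypergraph \<Rightarrow> 'a set \<Rightarrow> 'a hypergraph" where
  "add_edge H e = H\<lparr>edges := insert e (edges H)\<rparr>"

text \<open>The injection \<open>f\<close> is the identification of the vertices of \<open>F\<close> with distinct vertices
  of \<open>B\<close>.\<close>

definition is_Berge :: "'b hypergraph \<Rightarrow> 'a hypergraph \<Rightarrow> bool" where
  "is_Berge F B \<longleftrightarrow>
     (\<exists>f \<phi>. inj_on f (verts F) \<and> f ` verts F \<subseteq> verts B \<and>
            bij_betw \<phi> (edges F) (edges B) \<and> (\<forall>e \<in> edges F. f ` e \<subseteq> \<phi> e))"

definition contains_Berge :: "'b hypergraph \<Rightarrow> 'a hypergraph \<Rightarrow> bool" where
  "contains_Berge F H \<longleftrightarrow> (\<exists>B. subhypergraph B H \<and> is_Berge F B)"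

definition Berge_saturated :: "nat \<Rightarrow> 'b hypergraph \<Rightarrow> 'a hypergraph \<Rightarrow> bool" where
  "Berge_saturated k F H \<longleftrightarrow>
     is_hypergraph H \<and> uniform k H \<and> \<not> contains_Berge F H \<and>
     (\<forall>e. e \<subseteq> verts H \<and> card e = k \<and> e \<notin> edges H \<longrightarrow> contains_Berge F (add_edge H e))"

text \<open>Every finite hypergraph is isomorphic to one with vertices in \<^typ>\<open>nat\<close>. An infimum in
  \<^typ>\<open>enat\<close> is \<open>\<infinity>\<close> if there is no saturated hypergraph, so a finite value is a minimum that is
  attained.\<close>

definition sat_Berge :: "nat \<Rightarrow> nat \<Rightarrow> 'b hypergraph \<Rightarrow> enat" where
  "sat_Berge k n F =
     (INF H \<in> {H :: nat hypergraph. card (verts H) = n \<and> Berge_saturated k F H}.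
        enat (card (edges H)))"

definition matching_graph :: "nat \<Rightarrow> nat hypergraph" where
  "matching_graph l = \<lparr>verts = {..<2 * l}, edges = (\<lambda>i. {2 * i, 2 * i + 1}) ` {..<l}\<rparr>"

end

theory Submission imports Defs "HOL-Library.Disjoint_Sets" begin

text \<open>
  The lower bound is a count. A hypergraph containing a Berge-\<open>F\<close> has at least as many edges as
  \<open>F\<close>. So a saturated hypergraph in which some \<open>k\<close>-set is not an edge has at least \<open>l - 1\<close>
  edges, because one additional edge brings the number up to \<open>l\<close>. If all \<open>k\<close>-sets are
  edges, then the hypothesis \<open>n \<ge> k * (l - 1)\<close> provides \<open>l - 1\<close> disjoint ones.

  The bound is attained by \<open>l - 1\<close> pairwise disjoint edges, again available because
  \<open>n \<ge> k * (l - 1)\<close>. A new edge \<open>e\<close> has the same size as the old ones and differs from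
  them, so it is not contained in any one of them; therefore it has two vertices that lie in no
  common old edge (lemma \<open>two_points_separated\<close>). Let \<open>e\<close> be represented by these two vertices.
  They take at most one vertex away from each old edge, and as \<open>k \<ge> 3\<close>, every old edge keeps
  two vertices by which it can be represented. The pairs chosen are disjoint and form the
  matching (lemma \<open>disjoint_edges_Berge_saturated\<close>).
\<close>

lemma finite_edges_if_is_hypergraph:
  assumes "is_hypergraph H"
  shows "finite (edges H)"
  using assms finite_subset[of "edges H" "Pow (verts H)"] by (auto simp: is_hypergraph_def)

lemma inj_on_matching_edge: "inj_on (\<lambda>i::nat. {2 * i, 2 * i + 1}) A"
proof (rule inj_onI)
  fix x y :: nat assume "{2 * x, 2 * x + 1} = {2 * y, 2 * y + 1}"
  then have "2 * x = 2 * y \<or> 2 * x = 2 * y + 1" by (simp only: doubleton_eq_iff) blast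
  then show "x = y" by presburger
qed

lemma card_edges_matching_graph: "card (edges (matching_graph l)) = l"
  by (simp add: matching_graph_def card_image[OF inj_on_matching_edge, simplified])

lemma card_edges_le_if_contains_Berge:
  assumes "contains_Berge F H" "finite (edges H)"
  shows "card (edges F) \<le> card (edges H)"
proof -
  obtain B where "edges B \<subseteq> edges H" "is_Berge F B"
    using assms(1) by (auto simp: contains_Berge_def subhypergraph_def)
  then show ?thesis
    using assms(2) by (metis is_Berge_def bij_betw_same_card card_mono)
qed

text \<open>The identification of vertices required for a Berge matching amounts to a choice of a pair of
  vertices inside each edge such that the pairs are disjoint. Indexing the pairs by the edges
  themselves makes this convenient to apply.\<close>

lemma contains_Berge_matching_if_disjoint_pairs:
  assumes H: "is_hypergraph H" and E: "E \<subseteq> edges H" "card E = l"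
    and P: "\<And>e. e \<in> E \<Longrightarrow> P e \<subseteq> e \<and> card (P e) = 2" "disjoint_family_on P E"
  shows "contains_Berge (matching_graph l) H"
proof -
  have "finite E"
    using finite_edges_if_is_hypergraph[OF H] E(1) finite_subset by blast
  then obtain M where M: "bij_betw M {..<l} E"
    using ex_bij_betw_nat_finite[of E] E(2) by (auto simp: lessThan_atLeast0)
  have ME: "M i \<in> E" if "i < l" for i
    using M that by (auto simp: bij_betw_def)
  have "\<forall>i\<in>{..<l}. \<exists>q. P (M i) = {fst q, snd q} \<and> fst q \<noteq> snd q"
    using P(1) ME by (force simp: card_2_iff)
  then obtain q where q: "\<And>i. i < l \<Longrightarrow> P (M i) = {fst (q i), snd (q i)} \<and> fst (q i) \<noteq> snd (q i)"
    by (metis lessThan_iff)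
  let ?f = "\<lambda>v. if even v then fst (q (v div 2)) else snd (q (v div 2))"
  let ?p = "\<lambda>i::nat. {2 * i, 2 * i + 1}"
  let ?\<phi> = "\<lambda>e. M (inv_into {..<l} ?p e)"
  let ?F = "matching_graph l"
  have f_mem: "?f v \<in> P (M (v div 2))" if "v < 2 * l" for v
  proof -
    have "v div 2 < l" using that by simp
    from q[OF this] show ?thesis by auto
  qed
  have inj: "inj_on ?f (verts ?F)"
  proof (rule inj_onI)
    fix v w assume "v \<in> verts ?F" "w \<in> verts ?F" and eq: "?f v = ?f w"
    then have lt: "v < 2 * l" "w < 2 * l" by (auto simp: matching_graph_def)
    then have lt': "v div 2 < l" "w div 2 < l" by auto
    have "?f v \<in> P (M (v div 2)) \<inter> P (M (w div 2))"
      using f_mem[OF lt(1)] f_mem[OF lt(2)] unfolding eq by blast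
    then have "M (v div 2) = M (w div 2)"
      using P(2) ME[OF lt'(1)] ME[OF lt'(2)] unfolding disjoint_family_on_def by blast
    then have half: "v div 2 = w div 2"
      using M lt' by (auto simp: bij_betw_def dest: inj_onD)
    then have "even v \<longleftrightarrow> even w"
      using eq q[OF lt'(1)] by (auto split: if_splits)
    with half show "v = w" by presburger
  qed
  have pair_subset: "P (M i) \<subseteq> M i" if "i < l" for i
    using P(1) ME that by blast
  have "edges ?F = ?p ` {..<l}" by (simp add: matching_graph_def)
  then have "bij_betw ?p {..<l} (edges ?F)"
    by (simp only: bij_betw_def inj_on_matching_edge simp_thms)
  then have \<phi>: "bij_betw ?\<phi> (edges ?F) E"
    using bij_betw_trans[OF bij_betw_inv_into M] by (simp add: comp_def)
  have \<phi>_sub: "?f ` e \<subseteq> ?\<phi> e" if "e \<in> edges ?F" for e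
  proof -
    from that obtain i where i: "i < l" "e = ?p i" by (auto simp: matching_graph_def)
    then have "?\<phi> e = M i"
      using inv_into_f_f[OF inj_on_matching_edge, of i "{..<l}"] by simp
    then show ?thesis using q[OF i(1)] pair_subset[OF i(1)] i(2) by auto
  qed
  have "?f ` verts ?F \<subseteq> verts H"
  proof
    fix x assume "x \<in> ?f ` verts ?F"
    then obtain v where v: "v < 2 * l" "x = ?f v" by (auto simp: matching_graph_def)
    then have half: "v div 2 < l" by simp
    have "x \<in> M (v div 2)" using f_mem[OF v(1)] pair_subset[OF half] v(2) by blast
    moreover have "M (v div 2) \<in> edges H" using ME[OF half] E(1) by blast
    ultimately show "x \<in> verts H" using H by (auto simp: is_hypergraph_def)
  qed
  with inj \<phi> \<phi>_sub have "is_Berge ?F \<lparr>verts = verts H, edges = E\<rparr>"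
    unfolding is_Berge_def by (intro exI[of _ ?f] exI[of _ ?\<phi>]) simp
  moreover have "subhypergraph \<lparr>verts = verts H, edges = E\<rparr> H"
    using H E(1) by (auto simp: subhypergraph_def is_hypergraph_def)
  ultimately show ?thesis unfolding contains_Berge_def by blast
qed

text \<open>Such a family is the edge set of the extremal hypergraph, and in the lower bound it supplies
  either a \<open>k\<close>-set that is not an edge or enough edges.\<close>

lemma ex_disjoint_k_subsets:
  assumes "finite V" "k * m \<le> card V" "0 < k"
  shows "\<exists>D \<subseteq> Pow V. card D = m \<and> disjoint D \<and> (\<forall>d \<in> D. card d = k)"
  using assms(1,2)
proof (induction m arbitrary: V)
  case 0
  show ?case by (rule exI[of _ "{}"]) simp
next
  case (Suc m)
  then obtain A where A: "A \<subseteq> V" "card A = k"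
    by (metis obtain_subset_with_card_n mult_Suc_right add_leE)
  then have "k * m \<le> card (V - A)"
    using Suc.prems by (simp add: card_Diff_subset finite_subset)
  then obtain D where D: "D \<subseteq> Pow (V - A)" "card D = m" "disjoint D" "\<forall>d \<in> D. card d = k"
    using Suc.IH[of "V - A"] Suc.prems(1) by auto
  have "finite D" using D(1) Suc.prems(1) finite_subset by blast
  moreover have "A \<notin> D"
  proof
    assume "A \<in> D"
    then have "A = {}" using D(1) by blast
    then show False using A(2) \<open>0 < k\<close> by simp
  qed
  moreover have "disjoint (insert A D)"
    using D(1,3) by (auto simp: pairwise_insert disjnt_def)
  ultimately show ?case
    using A D by (intro exI[of _ "insert A D"]) auto
qed

lemma card_edges_ge_if_Berge_saturated:
  assumes sat: "Berge_saturated k F H" and "0 < k"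
    and card: "k * (card (edges F) - 1) \<le> card (verts H)"
  shows "card (edges F) - 1 \<le> card (edges H)"
proof (rule ccontr)
  assume less: "\<not> ?thesis"
  have H: "is_hypergraph H" using sat by (simp add: Berge_saturated_def)
  have fin: "finite (edges H)" using finite_edges_if_is_hypergraph[OF H] .
  obtain D where D: "D \<subseteq> Pow (verts H)" "card D = card (edges F) - 1" "\<forall>d \<in> D. card d = k"
    using ex_disjoint_k_subsets[OF _ card \<open>0 < k\<close>] H by (auto simp: is_hypergraph_def)
  have "\<not> D \<subseteq> edges H" using card_mono[OF fin] D(2) less by metis
  then obtain e where "e \<subseteq> verts H" "card e = k" "e \<notin> edges H" using D by blast
  then have "contains_Berge F (add_edge H e)"
    using sat by (simp add: Berge_saturated_def)
  then have "card (edges F) \<le> card (insert e (edges H))"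
    using card_edges_le_if_contains_Berge fin by (fastforce simp: add_edge_def)
  also have "\<dots> \<le> Suc (card (edges H))" by (rule card_insert_le_m1) auto
  finally show False using less by simp
qed

lemma two_points_separated:
  assumes "disjoint D" "2 \<le> card e" "\<And>d. d \<in> D \<Longrightarrow> \<not> e \<subseteq> d"
  obtains x y where "x \<in> e" "y \<in> e" "x \<noteq> y" "\<And>d. d \<in> D \<Longrightarrow> \<not> (x \<in> d \<and> y \<in> d)"
proof -
  obtain x z where xz: "x \<in> e" "z \<in> e" "x \<noteq> z"
    using assms(2) by (auto simp: card_le_Suc_iff numeral_2_eq_2)
  show thesis
  proof (cases "\<exists>d\<in>D. x \<in> d")
    case True
    then obtain d where d: "d \<in> D" "x \<in> d" by blast
    then obtain y where "y \<in> e" "y \<notin> d" using assms(3) by blast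
    \<comment> \<open>By disjointness \<open>d\<close> is the only member of \<open>D\<close> containing \<open>x\<close>.\<close>
    then show thesis using that[of x y] d xz(1) assms(1)
      unfolding pairwise_def disjnt_def by blast
  next
    case False
    then show thesis using that[of x z] xz by blast
  qed
qed

text \<open>The extremal hypergraph. Uniformity is what keeps a new edge from lying inside an old one, and
  size three is what leaves two vertices in an old edge that has lost one to the new edge.\<close>

lemma disjoint_edges_Berge_saturated:
  assumes H: "is_hypergraph H" and k: "uniform k H" "3 \<le> k" and disj: "disjoint (edges H)"
  shows "Berge_saturated k (matching_graph (Suc (card (edges H)))) H"
proof -
  let ?F = "matching_graph (Suc (card (edges H)))"
  have fin: "finite (edges H)" using finite_edges_if_is_hypergraph[OF H] .
  have "\<not> contains_Berge ?F H"
    using card_edges_le_if_contains_Berge[OF _ fin, of ?F] by (auto simp: card_edges_matching_graph)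
  moreover have "contains_Berge ?F (add_edge H e)"
    if e: "e \<subseteq> verts H" "card e = k" "e \<notin> edges H" for e
  proof -
    have card_d: "card d = k" "finite d" if "d \<in> edges H" for d
      using that k H by (auto simp: uniform_def is_hypergraph_def intro: finite_subset)
    have not_sub: "\<not> e \<subseteq> d" if "d \<in> edges H" for d
      using card_subset_eq[of d e] card_d[OF that] e(2,3) that by auto
    obtain x y where xy: "x \<in> e" "y \<in> e" "x \<noteq> y" "\<And>d. d \<in> edges H \<Longrightarrow> \<not> (x \<in> d \<and> y \<in> d)"
      by (rule two_points_separated[of "edges H" e]) (use disj not_sub e(2) k(2) in auto)
    have "\<exists>p. p \<subseteq> d - {x, y} \<and> card p = 2" if d: "d \<in> edges H" for d
    proof -
      obtain z where z: "d - {x, y} = d - {z}" using xy(4)[OF d] by blast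
      have "2 \<le> card (d - {z})"
        using card_d[OF d] k(2) by (cases "z \<in> d") (simp_all add: card_Diff_singleton)
      then have "2 \<le> card (d - {x, y})" by (simp only: z)
      then show ?thesis by (meson obtain_subset_with_card_n)
    qed
    then obtain p where p: "\<And>d. d \<in> edges H \<Longrightarrow> p d \<subseteq> d - {x, y} \<and> card (p d) = 2"
      by metis
    define P where "P = p(e := {x, y})"
    have P_old: "P d = p d" if "d \<in> edges H" for d using that e(3) by (auto simp: P_def)
    have P_new: "P e = {x, y}" by (simp add: P_def)
    show ?thesis
    proof (rule contains_Berge_matching_if_disjoint_pairs)
      show "is_hypergraph (add_edge H e)"
        using H e(1) by (auto simp: is_hypergraph_def add_edge_def)
      show "insert e (edges H) \<subseteq> edges (add_edge H e)" by (simp add: add_edge_def)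
      show "card (insert e (edges H)) = Suc (card (edges H))" using fin e(3) by simp
      show "P d \<subseteq> d \<and> card (P d) = 2" if "d \<in> insert e (edges H)" for d
      proof (cases "d = e")
        case True
        then show ?thesis using xy(1-3) by (simp add: P_new)
      next
        case False
        then have d: "d \<in> edges H" using that by simp
        show ?thesis unfolding P_old[OF d] using p[OF d] by (simp add: subset_Diff_insert)
      qed
      have "P d \<inter> P e = {}" if "d \<in> edges H" for d
        unfolding P_old[OF that] P_new using p[OF that] by (simp add: subset_Diff_insert)
      moreover have "P c \<inter> P d = {}" if "c \<in> edges H" "d \<in> edges H" "c \<noteq> d" for c d
      proof -
        have "c \<inter> d = {}" using disj that by (auto simp: pairwise_def disjnt_def)
        then show ?thesis
          unfolding P_old[OF that(1)] P_old[OF that(2)] using p[OF that(1)] p[OF that(2)] by blast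
      qed
      ultimately show "disjoint_family_on P (insert e (edges H))"
        unfolding disjoint_family_on_def by blast
    qed
  qed
  ultimately show ?thesis using H k(1) by (simp add: Berge_saturated_def)
qed

theorem theorem5p1:
  fixes k l n :: nat
  assumes "k \<ge> 3" and "l \<ge> 1" and "n \<ge> k * (l - 1)"
  shows "sat_Berge k n (matching_graph l) = enat (l - 1)"
proof (rule antisym)
  obtain D where D: "D \<subseteq> Pow {..<n}" "card D = l - 1" "disjoint D" "\<forall>d \<in> D. card d = k"
    using ex_disjoint_k_subsets[of "{..<n}" k "l - 1"] assms by auto
  let ?H = "\<lparr>verts = {..<n}, edges = D\<rparr>"
  have "Berge_saturated k (matching_graph l) ?H"
    using disjoint_edges_Berge_saturated[of ?H k] D assms(1,2)
    by (auto simp: is_hypergraph_def uniform_def)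
  then show "sat_Berge k n (matching_graph l) \<le> enat (l - 1)"
    unfolding sat_Berge_def using D(2) by (intro INF_lower2[of ?H]) auto
next
  show "enat (l - 1) \<le> sat_Berge k n (matching_graph l)"
    unfolding sat_Berge_def
  proof (rule INF_greatest)
    fix H :: "nat hypergraph"
    assume "H \<in> {H. card (verts H) = n \<and> Berge_saturated k (matching_graph l) H}"
    then show "enat (l - 1) \<le> enat (card (edges H))"
      using card_edges_ge_if_Berge_saturated[of k "matching_graph l" H] assms
      by (simp add: card_edges_matching_graph)
  qed
qed

end
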